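(* Let $X$ be a Hilbert space and let $J:X\to\mathbb{R}$ be first order differentiable, convex and $L$-descent (with $L>0$), with a minimizer $x^\star\in X$. Let $0<\kappa<1/L$, let $k\ge1$, and consider the inexact gradient iteration $$x^{(i+1)}=x^{(i)}-\kappa\big(\nabla J(x^{(i)})+\xi^{(i)}\big),\qquad i=0,\dots,k-1,$$ with starting point $x^{(0)}\in X$ and gradient errors $\xi^{(i)}\in X$. (1) If $\|\xi^{(i)}\|_X<\frac{2-\kappa L}{4-\kappa L}\|\nabla J(x^{(i)})\|_X$ for $i=0,\dots,k-1$, then the objective function is decreasing: $J(x^{(i+1)})<J(x^{(i)})$ for $i=0,\dots,k-1$. (2) Suppose in addition that $\delta$ (the iteration termination tolerance) and $\epsilon$ are constants such that $$\|\xi^{(i)}\|_X\le\epsilon<\frac{2-\kappa L}{4-\kappa L}\|\nabla J(x^{(i)})\|_X\quad\text{for all } i=0,\dots,k-1,\qquad \delta\ge\|x^{(0)}-x^\star\|_X\,\epsilon+\frac{\kappa\epsilon^2}{2\eta}>0,$$ where $\eta=1-\kappa L\in(0,1)$. Then either there exists an $i\in\{0,\dots,k\}$ at which the iteration terminates, i.e. $J(x^{(i)})-J(x^\star)<\delta$, or $$J(x^{(k)})-J(x^\star)\le\frac{1}{2k\kappa}\|x^{(0)}-x^\star\|_X^2+\|x^{(0)}-x^\star\|_X\,\epsilon+\frac{\kappa\epsilon^2}{2\eta}.$$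
   Context: $J'(x)$ is the derivative of $J$ at $x$ (a bounded linear functional on $X$), and $\nabla J(x)\in X$ is its Riesz representative: $\langle J'(x),y\rangle=(\nabla J(x),y)_X$ for all $y\in X$. $J$ is $L$-descent if $J(y)\le J(x)+\langle J'(x),y-x\rangle+\frac L2\|y-x\|_X^2$ for all $x,y\in X$. Standing assumption: the computed gradient $\nabla J(x^{(i)})+\xi^{(i)}$ is never zero, so $x^{(i+1)}\ne x^{(i)}$. *)

theory Defs
  imports "HOL-Analysis.Analysis"
begin

text \<open>The Riesz representative of the Frechet derivative. It is unique whenever it exists, and on a
  Hilbert space it exists at every point of differentiability (lemma \<open>riesz_gradient\<close> below).\<close>

definition riesz_gradient :: "('a::real_inner \<Rightarrow> real) \<Rightarrow> 'a \<Rightarrow> 'a" where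
  "riesz_gradient J x = (THE g. \<forall>y. frechet_derivative J (at x) y = inner g y)"

definition L_descent :: "real \<Rightarrow> ('a::real_inner \<Rightarrow> real) \<Rightarrow> bool" where
  "L_descent L J \<longleftrightarrow>
     (\<forall>x y. J y \<le> J x + frechet_derivative J (at x) (y - x) + L / 2 * (norm (y - x))\<^sup>2)"

text \<open>Riesz representation, by minimizing \<open>(norm x)\<^sup>2 / 2 - f x\<close>.\<close>

lemma riesz_representation:
  fixes f :: "'a::{real_inner,complete_space} \<Rightarrow> real"
  assumes "bounded_linear f"
  shows "\<exists>!g. \<forall>y. f y = inner g y"
proof -
  interpret f: bounded_linear f by fact
  obtain K where K: "\<And>x. norm (f x) \<le> norm x * K" using f.bounded by blast
  define \<phi> where "\<phi> x = (norm x)\<^sup>2 / 2 - f x" for x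
  have low: "- (K\<^sup>2) / 2 \<le> \<phi> x" for x
  proof -
    have "f x \<le> norm x * K" using K[of x] by simp
    moreover have "0 \<le> (norm x - K)\<^sup>2" by simp
    ultimately show ?thesis by (simp add: \<phi>_def power2_diff)
  qed
  define m where "m = (INF x. \<phi> x)"
  have bdd: "bdd_below (range \<phi>)" using low by (rule bdd_belowI2)
  have m_le: "m \<le> \<phi> x" for x unfolding m_def by (rule cINF_lower[OF bdd]) simp
  have "\<exists>x. \<phi> x < m + 1 / real (Suc n)" for n
  proof -
    have "(INF x. \<phi> x) < m + 1 / real (Suc n)" unfolding m_def by simp
    then show ?thesis by (subst (asm) cINF_less_iff[OF _ bdd]) auto
  qed
  then obtain s where s: "\<And>n. \<phi> (s n) < m + 1 / real (Suc n)" by metis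
  have par: "(norm (u - v))\<^sup>2 = 4 * (\<phi> u + \<phi> v - 2 * \<phi> ((1/2) *\<^sub>R (u + v)))" for u v
    unfolding \<phi>_def f.scaleR f.add
    by (simp add: power2_norm_eq_inner inner_commute algebra_simps add_divide_distrib)
  have "Cauchy s"
  proof (rule metric_CauchyI)
    fix e :: real assume e: "0 < e"
    then obtain N where N: "inverse (real (Suc N)) < e\<^sup>2 / 8"
      using reals_Archimedean[of "e\<^sup>2 / 8"] by auto
    have near: "\<phi> (s n) < m + e\<^sup>2 / 8" if "N \<le> n" for n
    proof -
      have "1 / real (Suc n) \<le> inverse (real (Suc N))" using that by (simp add: field_simps)
      then show ?thesis using s[of n] N by linarith
    qed
    have "dist (s i) (s j) < e" if "N \<le> i" "N \<le> j" for i j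
    proof -
      have "\<phi> (s i) + \<phi> (s j) - 2 * \<phi> ((1/2) *\<^sub>R (s i + s j)) < e\<^sup>2 / 4"
        using near[OF that(1)] near[OF that(2)] m_le[of "(1/2) *\<^sub>R (s i + s j)"] by argo
      then have "(norm (s i - s j))\<^sup>2 < e\<^sup>2" unfolding par by argo
      then show ?thesis using e by (simp add: dist_norm power_less_imp_less_base)
    qed
    then show "\<exists>M. \<forall>i\<ge>M. \<forall>j\<ge>M. dist (s i) (s j) < e" by blast
  qed
  then obtain g where g: "s \<longlonglongrightarrow> g" using Cauchy_convergent convergent_def by blast
  have "(\<lambda>n. \<phi> (s n)) \<longlonglongrightarrow> \<phi> g"
    unfolding \<phi>_def by (intro tendsto_intros g f.tendsto) auto
  moreover have "(\<lambda>n. m + 1 / real (Suc n)) \<longlonglongrightarrow> m + 0"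
    by (intro tendsto_intros LIMSEQ_Suc[OF lim_1_over_n])
  ultimately have "\<phi> g \<le> m + 0" using s by (intro LIMSEQ_le) (auto intro: less_imp_le)
  then have g_min: "\<phi> g \<le> \<phi> x" for x using m_le[of x] by simp
  have rep: "f h = inner g h" for h
  proof -
    define c where "c = inner g h - f h"
    define B where "B = (norm h)\<^sup>2"
    define t where "t = - c / (B + 1)"
    have B: "0 \<le> B" unfolding B_def by simp
    have "\<phi> (g + t *\<^sub>R h) = \<phi> g + t * c + t\<^sup>2 * B / 2"
      unfolding \<phi>_def f.scaleR f.add c_def B_def power2_norm_eq_inner
      by (simp add: inner_commute algebra_simps power2_eq_square add_divide_distrib)
    then have "0 \<le> t * c + t\<^sup>2 * B / 2" using g_min[of "g + t *\<^sub>R h"] by linarith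
    also have "t * c + t\<^sup>2 * B / 2 = - (c\<^sup>2 * (B + 2)) / (2 * (B + 1)\<^sup>2)"
      using B unfolding t_def by (simp add: divide_simps power2_eq_square) (simp add: algebra_simps)
    finally have "c\<^sup>2 * (B + 2) \<le> 0" using B by (simp add: divide_simps split: if_splits)
    then have "c\<^sup>2 \<le> 0" using B by (simp add: mult_le_0_iff)
    then show ?thesis unfolding c_def by simp
  qed
  show ?thesis
  proof (rule ex1I[of _ g])
    show "\<forall>y. f y = inner g y" using rep by blast
    fix g' assume "\<forall>y. f y = inner g' y"
    then have "inner (g' - g) y = 0" for y using rep by (simp add: inner_diff_left)
    then show "g' = g" by (metis inner_eq_zero_iff right_minus_eq)
  qed
qed

lemma riesz_gradient:
  fixes J :: "'a::{real_inner,complete_space} \<Rightarrow> real"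
  assumes "J differentiable (at x)"
  shows "frechet_derivative J (at x) y = inner (riesz_gradient J x) y"
proof -
  have "bounded_linear (frechet_derivative J (at x))"
    using assms frechet_derivative_works has_derivative_bounded_linear by blast
  from theI'[OF riesz_representation[OF this]] show ?thesis
    unfolding riesz_gradient_def by blast
qed

end

theory Submission
  imports Defs
begin

text \<open>
  Write \<open>d = riesz_gradient J x + e\<close> for the computed gradient at \<open>x\<close>. The descent inequality along the
  step \<open>x - \<kappa> d\<close> bounds the change of \<open>J\<close> by \<open>- \<kappa> ((1 - \<kappa> L / 2) \<bar>d\<bar>\<^sup>2 - (e, d))\<close>, and the relative
  error bound is what makes \<open>\<bar>e\<bar> < (1 - \<kappa> L / 2) \<bar>d\<bar>\<close>, by the triangle inequality
  \<open>\<bar>d\<bar> \<ge> \<bar>grad\<bar> - \<bar>e\<bar>\<close>. Hence every step decreases \<open>J\<close> (\<open>inexact_step_decreases\<close>).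

  For the rate, convexity converts the gap \<open>J x - J xstar\<close> into an inner product with \<open>x - xstar\<close>, and
  completing the square in \<open>xstar\<close> turns the descent inequality into the one-step estimate
  \<open>J (x - \<kappa> d) - J xstar \<le> (r\<^sup>2 - s\<^sup>2) / (2 \<kappa>) + r \<epsilon> + \<kappa> \<epsilon>\<^sup>2 / (2 \<eta>)\<close>,
  where \<open>r\<close> and \<open>s\<close> are the distances to \<open>xstar\<close> before and after the step
  (\<open>inexact_step_gap\<close>). The squares telescope, but the term \<open>r \<epsilon>\<close> is useful only if \<open>r\<close> does not exceed
  the initial distance \<open>r\<^sub>0\<close>. This is where the tolerance enters: as long as the iteration has not
  terminated, the gap is at least \<open>r\<^sub>0 \<epsilon> + \<kappa> \<epsilon>\<^sup>2 / (2 \<eta>)\<close>, so \<open>r \<le> r\<^sub>0\<close> and the estimate force \<open>s \<le> r\<close>,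
  and the distances stay below \<open>r\<^sub>0\<close> by induction. Summing the estimates and using that the last gap is
  the smallest one gives the bound.
\<close>

text \<open>Restricting \<open>J\<close> to the line through \<open>x\<close> and \<open>y\<close> reduces this to the tangent inequality for
  convex functions of one real variable.\<close>

lemma convex_above_tangent_frechet:
  fixes J :: "'a::real_normed_vector \<Rightarrow> real"
  assumes "J differentiable (at x)" and "convex_on UNIV J"
  shows "J x + frechet_derivative J (at x) (y - x) \<le> J y"
proof -
  define l where "l t = x + t *\<^sub>R (y - x)" for t :: real
  define D where "D = frechet_derivative J (at x)"
  have D: "(J has_derivative D) (at (l 0))"
    using assms(1) unfolding D_def l_def by (simp add: frechet_derivative_works)
  interpret D: bounded_linear D using D by (rule has_derivative_bounded_linear)
  have l: "(l has_derivative (\<lambda>t. t *\<^sub>R (y - x))) (at 0)"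
    unfolding l_def by (auto intro!: derivative_eq_intros)
  have "((\<lambda>t. J (l t)) has_derivative (\<lambda>t. D (t *\<^sub>R (y - x)))) (at 0)"
    using has_derivative_compose[OF l D] .
  then have "((\<lambda>t. J (l t)) has_field_derivative D (y - x)) (at 0)"
    unfolding has_field_derivative_def by (simp add: D.scaleR mult_commute_abs)
  moreover have "convex_on UNIV (\<lambda>t. J (l t))"
  proof (rule convex_onI)
    fix t u v :: real assume "0 < t" "t < 1"
    moreover have "l ((1 - t) *\<^sub>R u + t *\<^sub>R v) = (1 - t) *\<^sub>R l u + t *\<^sub>R l v"
      unfolding l_def by (simp add: algebra_simps)
    ultimately show "J (l ((1 - t) *\<^sub>R u + t *\<^sub>R v)) \<le> (1 - t) * J (l u) + t * J (l v)"
      using convex_onD[OF assms(2), of t "l u" "l v"] by simp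
  qed simp
  ultimately have "D (y - x) * (1 - 0) \<le> J (l 1) - J (l 0)"
    by (intro convex_on_imp_above_tangent[where A = UNIV and f = "\<lambda>t. J (l t)"]) simp_all
  then show ?thesis unfolding l_def D_def by simp
qed

text \<open>The descent inequality along the step, with the true gradient \<open>d - e\<close> expressed through the
  computed one.\<close>

lemma inexact_step_descent:
  fixes J :: "'a::{real_inner,complete_space} \<Rightarrow> real"
  assumes "J differentiable (at x)" and "L_descent L J"
    and d: "d = riesz_gradient J x + e"
  shows "J (x - \<kappa> *\<^sub>R d) \<le> J x - \<kappa> * ((1 - \<kappa> * L / 2) * (norm d)\<^sup>2 - inner e d)"
proof -
  have "J (x - \<kappa> *\<^sub>R d)
      \<le> J x + inner (riesz_gradient J x) (- (\<kappa> *\<^sub>R d)) + L / 2 * (norm (\<kappa> *\<^sub>R d))\<^sup>2"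
    using assms(2) riesz_gradient[OF assms(1)] unfolding L_descent_def
    by (metis (no_types, lifting) add_diff_cancel_left' diff_conv_add_uminus norm_minus_cancel)
  moreover have "riesz_gradient J x = d - e" using d by simp
  ultimately show ?thesis
    by (simp add: power2_norm_eq_inner inner_diff_left power_mult_distrib algebra_simps
        power2_eq_square[of \<kappa>])
qed

lemma inexact_step_decreases:
  fixes J :: "'a::{real_inner,complete_space} \<Rightarrow> real"
  assumes "J differentiable (at x)" and "L_descent L J"
    and "0 < \<kappa>" and "\<kappa> * L < 4"
    and d: "d = riesz_gradient J x + e" and "d \<noteq> 0"
    and e: "norm e < (2 - \<kappa> * L) / (4 - \<kappa> * L) * norm (riesz_gradient J x)"
  shows "J (x - \<kappa> *\<^sub>R d) < J x"
proof -
  define a where "a = \<kappa> * L"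
  have "a < 4" using assms(4) unfolding a_def .
  have e': "(4 - a) * norm e < (2 - a) * norm (riesz_gradient J x)"
    using e \<open>a < 4\<close> unfolding a_def[symmetric] by (simp add: field_simps)
  have "0 < 2 - a"
  proof (rule ccontr)
    assume "\<not> 0 < 2 - a"
    then have "(2 - a) * norm (riesz_gradient J x) \<le> 0" by (simp add: mult_nonpos_nonneg)
    moreover have "0 \<le> (4 - a) * norm e" using \<open>a < 4\<close> by simp
    ultimately show False using e' by linarith
  qed
  have "norm (riesz_gradient J x) \<le> norm d + norm e"
    unfolding d by (metis add_diff_cancel_right' norm_triangle_ineq4)
  then have "(2 - a) * norm (riesz_gradient J x) \<le> (2 - a) * (norm d + norm e)"
    using \<open>0 < 2 - a\<close> by (simp add: mult_left_mono)
  then have "norm e < (1 - a / 2) * norm d" using e' by (simp add: algebra_simps)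
  then have "norm e * norm d < (1 - a / 2) * (norm d)\<^sup>2"
    using \<open>d \<noteq> 0\<close> by (simp add: power2_eq_square flip: mult.assoc)
  then have "inner e d < (1 - a / 2) * (norm d)\<^sup>2"
    using norm_cauchy_schwarz[of e d] by linarith
  then have "0 < \<kappa> * ((1 - a / 2) * (norm d)\<^sup>2 - inner e d)" using \<open>0 < \<kappa>\<close> by simp
  then show ?thesis
    using inexact_step_descent[OF assms(1,2) d, of \<kappa>] unfolding a_def by linarith
qed

text \<open>Expanding \<open>\<bar>x - \<kappa> d - z\<bar>\<^sup>2\<close> absorbs the inner product that convexity provides, and leaves
  \<open>- \<kappa> \<eta> \<bar>d\<bar>\<^sup>2 / 2\<close> to spare. Together with the error term \<open>\<kappa> \<epsilon> \<bar>d\<bar>\<close> this is a concave quadratic in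
  \<open>\<bar>d\<bar>\<close> with maximum \<open>\<kappa> \<epsilon>\<^sup>2 / (2 \<eta>)\<close>.\<close>

lemma inexact_step_gap:
  fixes J :: "'a::{real_inner,complete_space} \<Rightarrow> real"
  assumes "J differentiable (at x)" and "L_descent L J" and "convex_on UNIV J"
    and "0 < \<kappa>" and \<eta>: "\<eta> = 1 - \<kappa> * L" and "0 < \<eta>"
    and d: "d = riesz_gradient J x + e" and e: "norm e \<le> \<epsilon>"
  shows "J (x - \<kappa> *\<^sub>R d) - J z
    \<le> ((norm (x - z))\<^sup>2 - (norm (x - \<kappa> *\<^sub>R d - z))\<^sup>2) / (2 * \<kappa>)
       + norm (x - z) * \<epsilon> + \<kappa> * \<epsilon>\<^sup>2 / (2 * \<eta>)"
proof -
  have tangent: "J x - J z \<le> inner (d - e) (x - z)"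
    using convex_above_tangent_frechet[OF assms(1,3), of z] riesz_gradient[OF assms(1), of "z - x"]
    unfolding d by (simp add: inner_diff_right)
  have "(norm (x - \<kappa> *\<^sub>R d - z))\<^sup>2
      = (norm (x - z))\<^sup>2 - 2 * \<kappa> * inner d (x - z) + \<kappa>\<^sup>2 * (norm d)\<^sup>2"
    unfolding power2_norm_eq_inner
    by (simp add: inner_diff_left inner_diff_right inner_commute algebra_simps
        power2_eq_square[of \<kappa>])
  then have square: "((norm (x - z))\<^sup>2 - (norm (x - \<kappa> *\<^sub>R d - z))\<^sup>2) / (2 * \<kappa>)
      = inner d (x - z) - \<kappa> / 2 * (norm d)\<^sup>2"
    using \<open>0 < \<kappa>\<close> by (simp add: field_simps power2_eq_square)
  have "inner e (z - x) \<le> norm (x - z) * \<epsilon>"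
    using norm_cauchy_schwarz[of e "z - x"] mult_right_mono[OF e norm_ge_zero[of "z - x"]]
    by (simp add: norm_minus_commute mult.commute)
  then have err1: "- inner e (x - z) \<le> norm (x - z) * \<epsilon>" by (simp add: inner_diff_right)
  have "inner e d \<le> \<epsilon> * norm d"
    using norm_cauchy_schwarz[of e d] mult_right_mono[OF e norm_ge_zero[of d]] by linarith
  moreover have "\<epsilon> * norm d - \<eta> / 2 * (norm d)\<^sup>2 \<le> \<epsilon>\<^sup>2 / (2 * \<eta>)"
  proof -
    have "0 \<le> (\<epsilon> - \<eta> * norm d)\<^sup>2 / (2 * \<eta>)" using \<open>0 < \<eta>\<close> by simp
    also have "\<dots> = \<epsilon>\<^sup>2 / (2 * \<eta>) - (\<epsilon> * norm d - \<eta> / 2 * (norm d)\<^sup>2)"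
      using \<open>0 < \<eta>\<close> by (simp add: field_simps power2_eq_square)
    finally show ?thesis by simp
  qed
  ultimately have "\<kappa> * (inner e d - \<eta> / 2 * (norm d)\<^sup>2) \<le> \<kappa> * (\<epsilon>\<^sup>2 / (2 * \<eta>))"
    using \<open>0 < \<kappa>\<close> by (intro mult_left_mono) auto
  then have err2: "\<kappa> * inner e d - \<kappa> * \<eta> / 2 * (norm d)\<^sup>2 \<le> \<kappa> * \<epsilon>\<^sup>2 / (2 * \<eta>)"
    by (simp add: right_diff_distrib mult.assoc)
  have "J (x - \<kappa> *\<^sub>R d) - J z
      \<le> (inner d (x - z) - \<kappa> / 2 * (norm d)\<^sup>2) - inner e (x - z)
         + (\<kappa> * inner e d - \<kappa> * \<eta> / 2 * (norm d)\<^sup>2)"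
    using inexact_step_descent[OF assms(1,2) d, of \<kappa>] tangent
    unfolding \<eta> inner_diff_left by argo
  then show ?thesis unfolding square using err1 err2 by linarith
qed

text \<open>The telescoping argument concerns only the numbers \<open>V i = J (x i) - J xstar\<close> and
  \<open>r i = norm (x i - xstar)\<close>; \<open>c\<close> stands for \<open>\<kappa> \<epsilon>\<^sup>2 / (2 \<eta>)\<close>.\<close>

lemma last_gap_le_of_telescoping:
  fixes V r :: "nat \<Rightarrow> real" and \<kappa> \<epsilon> c :: real
  assumes "1 \<le> k" and "0 < \<kappa>" and "0 \<le> \<epsilon>" and r_nonneg: "\<And>i. 0 \<le> r i"
    and decreasing: "\<And>i. i < k \<Longrightarrow> V (Suc i) \<le> V i"
    and step: "\<And>i. i < k \<Longrightarrow> V (Suc i) \<le> ((r i)\<^sup>2 - (r (Suc i))\<^sup>2) / (2 * \<kappa>) + r i * \<epsilon> + c"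
    and running: "\<And>i. i \<le> k \<Longrightarrow> r 0 * \<epsilon> + c \<le> V i"
  shows "V k \<le> 1 / (2 * real k * \<kappa>) * (r 0)\<^sup>2 + r 0 * \<epsilon> + c"
proof -
  \<comment> \<open>An iterate that has not terminated cannot be farther from the minimizer than its predecessor.\<close>
  have close: "r i \<le> r 0" if "i \<le> k" for i
    using that
  proof (induction i)
    case (Suc i)
    then have "r i * \<epsilon> \<le> r 0 * \<epsilon>" using \<open>0 \<le> \<epsilon>\<close> by (simp add: mult_right_mono)
    then have "0 \<le> ((r i)\<^sup>2 - (r (Suc i))\<^sup>2) / (2 * \<kappa>)"
      using Suc.prems step[of i] running[of "Suc i"] by simp
    then have "(r (Suc i))\<^sup>2 \<le> (r i)\<^sup>2" using \<open>0 < \<kappa>\<close> by (simp add: zero_le_divide_iff)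
    then have "r (Suc i) \<le> r i" using power2_le_imp_le r_nonneg by blast
    then show ?case using Suc.IH Suc.prems by linarith
  qed simp
  have last: "V k \<le> V i" if "i \<le> k" for i
    using that
  proof (induction rule: inc_induct)
    case (step n)
    then show ?case using decreasing[of n] by linarith
  qed simp
  have "V k \<le> ((r i)\<^sup>2 - (r (Suc i))\<^sup>2) / (2 * \<kappa>) + (r 0 * \<epsilon> + c)" if "i < k" for i
  proof -
    have "r i * \<epsilon> \<le> r 0 * \<epsilon>" using close[of i] that \<open>0 \<le> \<epsilon>\<close> by (simp add: mult_right_mono)
    then show ?thesis using step[OF that] last[of "Suc i"] that by simp
  qed
  then have "(\<Sum>i<k. V k) \<le> (\<Sum>i<k. ((r i)\<^sup>2 - (r (Suc i))\<^sup>2) / (2 * \<kappa>) + (r 0 * \<epsilon> + c))"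
    by (intro sum_mono) simp
  also have "\<dots> = ((r 0)\<^sup>2 - (r k)\<^sup>2) / (2 * \<kappa>) + real k * (r 0 * \<epsilon> + c)"
    unfolding sum.distrib sum_divide_distrib[symmetric]
      sum_lessThan_telescope'[of "\<lambda>i. (r i)\<^sup>2"] by (simp add: distrib_left)
  also have "\<dots> \<le> (r 0)\<^sup>2 / (2 * \<kappa>) + real k * (r 0 * \<epsilon> + c)"
    using \<open>0 < \<kappa>\<close> by (simp add: divide_right_mono)
  finally have "real k * V k \<le> (r 0)\<^sup>2 / (2 * \<kappa>) + real k * (r 0 * \<epsilon> + c)" by simp
  then have "V k \<le> ((r 0)\<^sup>2 / (2 * \<kappa>) + real k * (r 0 * \<epsilon> + c)) / real k"
    using \<open>1 \<le> k\<close> by (simp add: pos_le_divide_eq mult.commute)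
  also have "\<dots> = 1 / (2 * real k * \<kappa>) * (r 0)\<^sup>2 + r 0 * \<epsilon> + c"
    using \<open>1 \<le> k\<close> \<open>0 < \<kappa>\<close> by (simp add: field_simps)
  finally show ?thesis .
qed

theorem theorem11:
  fixes J :: "'a::{real_inner,complete_space} \<Rightarrow> real"
    and L \<kappa> \<eta> :: real
    and k :: nat
    and x \<xi> :: "nat \<Rightarrow> 'a"
    and xstar :: 'a
  assumes "\<forall>z. J differentiable (at z)"
    and "convex_on UNIV J"
    and "0 < L"
    and "L_descent L J"
    and "\<forall>z. J xstar \<le> J z"
    and "0 < \<kappa>" and "\<kappa> < 1 / L"
    and "\<eta> = 1 - \<kappa> * L"
    and "1 \<le> k"
    and "\<forall>i<k. x (Suc i) = x i - \<kappa> *\<^sub>R (riesz_gradient J (x i) + \<xi> i)"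
    and "\<forall>i<k. riesz_gradient J (x i) + \<xi> i \<noteq> 0"
  shows
    "((\<forall>i<k. norm (\<xi> i) < (2 - \<kappa> * L) / (4 - \<kappa> * L) * norm (riesz_gradient J (x i)))
       \<longrightarrow> (\<forall>i<k. J (x (Suc i)) < J (x i)))
     \<and>
     (\<forall>\<delta> \<epsilon>.
       (\<forall>i<k. norm (\<xi> i) < (2 - \<kappa> * L) / (4 - \<kappa> * L) * norm (riesz_gradient J (x i)))
       \<and> (\<forall>i<k. norm (\<xi> i) \<le> \<epsilon>
             \<and> \<epsilon> < (2 - \<kappa> * L) / (4 - \<kappa> * L) * norm (riesz_gradient J (x i)))
       \<and> norm (x 0 - xstar) * \<epsilon> + \<kappa> * \<epsilon>\<^sup>2 / (2 * \<eta>) \<le> \<delta>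
       \<and> 0 < norm (x 0 - xstar) * \<epsilon> + \<kappa> * \<epsilon>\<^sup>2 / (2 * \<eta>)
       \<longrightarrow> (\<exists>i\<le>k. J (x i) - J xstar < \<delta>)
         \<or> J (x k) - J xstar \<le> 1 / (2 * real k * \<kappa>) * (norm (x 0 - xstar))\<^sup>2
              + norm (x 0 - xstar) * \<epsilon> + \<kappa> * \<epsilon>\<^sup>2 / (2 * \<eta>))"
proof -
  have "\<kappa> * L < 1" using \<open>0 < L\<close> \<open>\<kappa> < 1 / L\<close> by (simp add: field_simps)
  then have "0 < \<eta>" and "\<kappa> * L < 4" using \<open>\<eta> = 1 - \<kappa> * L\<close> by simp_all
  have iter: "x (Suc i) = x i - \<kappa> *\<^sub>R (riesz_gradient J (x i) + \<xi> i)" if "i < k" for i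
    using assms(10) that by blast
  have decrease: "J (x (Suc i)) < J (x i)"
    if "\<forall>i<k. norm (\<xi> i) < (2 - \<kappa> * L) / (4 - \<kappa> * L) * norm (riesz_gradient J (x i))"
      and "i < k" for i
    unfolding iter[OF that(2)]
    using inexact_step_decreases[OF _ \<open>L_descent L J\<close> \<open>0 < \<kappa>\<close> \<open>\<kappa> * L < 4\<close> refl, of "x i" "\<xi> i"]
      assms(1,11) that by blast
  have rate: "J (x k) - J xstar \<le> 1 / (2 * real k * \<kappa>) * (norm (x 0 - xstar))\<^sup>2
      + norm (x 0 - xstar) * \<epsilon> + \<kappa> * \<epsilon>\<^sup>2 / (2 * \<eta>)"
    if small: "\<forall>i<k. norm (\<xi> i) < (2 - \<kappa> * L) / (4 - \<kappa> * L) * norm (riesz_gradient J (x i))"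
      and error: "\<forall>i<k. norm (\<xi> i) \<le> \<epsilon>"
      and tolerance: "norm (x 0 - xstar) * \<epsilon> + \<kappa> * \<epsilon>\<^sup>2 / (2 * \<eta>) \<le> \<delta>"
      and running: "\<And>i. i \<le> k \<Longrightarrow> \<delta> \<le> J (x i) - J xstar" for \<delta> \<epsilon>
  proof (rule last_gap_le_of_telescoping[where r = "\<lambda>i. norm (x i - xstar)"
        and V = "\<lambda>i. J (x i) - J xstar", OF \<open>1 \<le> k\<close> \<open>0 < \<kappa>\<close>])
    show "0 \<le> \<epsilon>" using error \<open>1 \<le> k\<close> norm_ge_zero[of "\<xi> 0"] by (meson less_le_trans order_trans zero_less_one)
    fix i
    show "0 \<le> norm (x i - xstar)" by simp
    show "norm (x 0 - xstar) * \<epsilon> + \<kappa> * \<epsilon>\<^sup>2 / (2 * \<eta>) \<le> J (x i) - J xstar" if "i \<le> k"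
      using tolerance running[OF that] by linarith
    assume i: "i < k"
    show "J (x (Suc i)) - J xstar \<le> J (x i) - J xstar" using decrease[OF small i] by simp
    show "J (x (Suc i)) - J xstar
        \<le> ((norm (x i - xstar))\<^sup>2 - (norm (x (Suc i) - xstar))\<^sup>2) / (2 * \<kappa>)
           + norm (x i - xstar) * \<epsilon> + \<kappa> * \<epsilon>\<^sup>2 / (2 * \<eta>)"
      unfolding iter[OF i]
      by (rule inexact_step_gap[OF _ \<open>L_descent L J\<close> \<open>convex_on UNIV J\<close> \<open>0 < \<kappa>\<close> \<open>\<eta> = 1 - \<kappa> * L\<close>
            \<open>0 < \<eta>\<close> refl]) (use assms(1) error i in blast)+
  qed
  show ?thesis
    using decrease rate by (meson not_less)
qed

end
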